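(* Let $(G_N)_{N\in\mathbb N}$ be a sequence of finite Abelian groups with $|G_N|\to\infty$. Write $G=G_N$, let $G=\oplus_{p\in\mathcal P}G_p$ be its decomposition into Abelian $p$-groups over a finite set $\mathcal P=\mathcal P_N$ of primes, and write $d:=d(G)$, $d_p:=d(G_p)$. The following dichotomy holds. (i) If there exists (for each $N$) $p\in\mathcal P$ such that both $p$ and $d-d_p$ are bounded uniformly in $N$, then $k-d\gg1$ is necessary for $\varphi_k(G)=1-o(1)$; that is, for any sequence $k=k_N$ with $\varphi_{k_N}(G_N)\to1$ one has $k_N-d(G_N)\to\infty$. (ii) If there exists a sequence $\omega=\omega_N\to\infty$ with $\min_{p\in\mathcal P\cap[1,\omega]}(d-d_p)\to\infty$ (the minimum over the empty set being $+\infty$), then $\varphi_{d+1}(G)=1-o(1)$.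
   Context: For a finite group $G$, $d(G)$ is the minimal size of a generating set of $G$, and $\varphi_k(G)$ is the probability that $k$ independent uniformly random elements of $G$ generate $G$. All quantities depend on $N$ and asymptotic notation refers to $N\to\infty$. *)

theory Defs
  imports "HOL-Probability.Product_PMF" "HOL-Algebra.Product_Groups"
begin

definition min_gens :: "('a, 'x) monoid_scheme \<Rightarrow> nat" where
  "min_gens G = (LEAST n. \<exists>S. S \<subseteq> carrier G \<and> finite S \<and> card S = n \<and> generate G S = carrier G)"

text \<open>The coordinates of \<open>Pi_pmf\<close> are independent and, here, each uniform on \<open>carrier G\<close>.
  Repetitions are allowed, and for \<open>k = 0\<close> the generated subgroup is trivial.\<close>

definition gen_prob :: "nat \<Rightarrow> ('a, 'x) monoid_scheme \<Rightarrow> real" where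
  "gen_prob k G =
     measure_pmf.prob (Pi_pmf {..<k} undefined (\<lambda>_. pmf_of_set (carrier G)))
       {Z. generate G (Z ` {..<k}) = carrier G}"

text \<open>For prime \<open>p\<close> the order condition also forces finiteness, since infinite carriers have
  \<open>order\<close> zero. The trivial group is included.\<close>

definition finite_abelian_p_group :: "nat \<Rightarrow> ('a, 'x) monoid_scheme \<Rightarrow> bool" where
  "finite_abelian_p_group p G \<longleftrightarrow>
     Factorial_Ring.prime p \<and> comm_group G \<and> (\<exists>n. order G = p ^ n)"

text \<open>\<open>G\<close> is (isomorphic to) the direct sum of nontrivial abelian \<open>p\<close>-groups \<open>H p\<close>, one for
  each prime \<open>p\<close> in the finite set \<open>P\<close>. Nontriviality makes \<open>P\<close> the set of prime divisors
  of the group order and \<open>H p\<close> the Sylow \<open>p\<close>-subgroup up to isomorphism.\<close>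

definition primary_decomposition ::
    "('a, 'x) monoid_scheme \<Rightarrow> nat set \<Rightarrow> (nat \<Rightarrow> ('b, 'y) monoid_scheme) \<Rightarrow> bool" where
  "primary_decomposition G P H \<longleftrightarrow>
     finite P \<and>
     (\<forall>p\<in>P. finite_abelian_p_group p (H p) \<and> order (H p) \<noteq> 1) \<and>
     G \<cong> sum_group P H"

end

theory Submission
  imports Defs "HOL-Algebra.Multiplicative_Group"
begin

text \<open>
  A tuple fails to generate a finite abelian group \<open>G\<close> iff it lies in the kernel of a nonzero
  homomorphism \<open>G \<rightarrow> \<int>/p\<close> for some prime \<open>p\<close> dividing \<open>|G|\<close>; such a kernel has index \<open>p\<close>.

  (i) Any \<open>d\<^sub>p - 1\<close> elements of \<open>G\<close> lie in a kernel of index \<open>p\<close>, and the remaining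
  \<open>k + 1 - d\<^sub>p\<close> elements fall into it with probability \<open>1 / p ^ (k + 1 - d\<^sub>p)\<close>. If \<open>p\<close>, \<open>d - d\<^sub>p\<close> and
  \<open>k - d\<close> are bounded, so is the failure probability from below.

  (ii) There are at most \<open>p ^ d\<^sub>p\<close> homomorphisms \<open>G \<rightarrow> \<int>/p\<close>, and every kernel of index \<open>p\<close> comes from
  \<open>p - 1\<close> of them, so the failure probability is at most the sum of
  \<open>p ^ d\<^sub>p / ((p - 1) * p ^ k)\<close> over \<open>p\<close>. For \<open>k = d + 1\<close> each term is at most \<open>2 / p\<^sup>2\<close> and tends to
  \<open>0\<close> for fixed \<open>p\<close>, so the sum tends to \<open>0\<close> by dominated convergence.
\<close>

section \<open>Minimal generating sets and homomorphic images\<close>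

lemma (in group) min_gens_le_card:
  assumes "S \<subseteq> carrier G" "finite S" "generate G S = carrier G"
  shows "min_gens G \<le> card S"
  unfolding min_gens_def by (rule Least_le) (use assms in blast)

lemma (in group) obtain_min_gens:
  assumes "finite (carrier G)"
  obtains S where "S \<subseteq> carrier G" "finite S" "card S = min_gens G" "generate G S = carrier G"
proof -
  have "\<exists>n S. S \<subseteq> carrier G \<and> finite S \<and> card S = n \<and> generate G S = carrier G"
    using assms generate_incl[of "carrier G"] generate.incl[of _ "carrier G" G] by blast
  from LeastI_ex[OF this] show thesis
    using that unfolding min_gens_def by blast
qed

lemma (in group_hom) min_gens_surj_le:
  assumes "finite (carrier G)" "h ` carrier G = carrier H"
  shows "min_gens H \<le> min_gens G"
proof -
  obtain S where S: "S \<subseteq> carrier G" "finite S" "card S = min_gens G" "generate G S = carrier G"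
    using G.obtain_min_gens[OF assms(1)] .
  have "min_gens H \<le> card (h ` S)"
    using S assms(2) by (intro H.min_gens_le_card) (auto simp: generate_img)
  also have "\<dots> \<le> min_gens G"
    using card_image_le[OF S(2)] S(3) by metis
  finally show ?thesis .
qed

text \<open>Cutting the codomain down to the image makes the map surjective, so the first
  isomorphism theorem matches cosets of the kernel with image points; Lagrange does the
  rest.\<close>

lemma (in group_hom) card_kernel_mult_card_image:
  "card (kernel G H h) * card (h ` carrier G) = order G"
proof -
  interpret h': group_hom G "H\<lparr>carrier := h ` carrier G\<rparr>" h
    using homh H.subgroup_imp_group[OF img_is_subgroup]
    by (intro group_hom.intro group_hom_axioms.intro) (auto simp: hom_def)
  have "bij_betw (\<lambda>X. the_elem (h ` X)) (rcosets (kernel G H h)) (h ` carrier G)"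
    using h'.FactGroup_iso_set by (simp add: iso_def FactGroup_def kernel_def)
  then show ?thesis
    using G.lagrange[OF subgroup_kernel] bij_betw_same_card by (metis mult.commute)
qed

section \<open>Characters: homomorphisms to the integers modulo a prime\<close>

text \<open>In an abelian group the quotient by a maximal proper subgroup \<open>M\<close> is
  simple, hence of prime order. The character is the quotient map for some \<open>M\<close>
  containing \<open>A\<close>, written out through exponents of an element outside
  \<open>M\<close>.\<close>

lemma (in comm_group) proper_subgroup_character:
  assumes fin: "finite (carrier G)" and A: "subgroup A G" "A \<noteq> carrier G"
  obtains p \<phi> where "Factorial_Ring.prime p" "p dvd order G"
    "\<phi> \<in> hom G (integer_mod_group p)" "\<And>x. x \<in> A \<Longrightarrow> \<phi> x = 0" "\<exists>x\<in>carrier G. \<phi> x \<noteq> 0"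
proof -
  define \<M> where "\<M> = {M. subgroup M G \<and> A \<subseteq> M \<and> M \<noteq> carrier G}"
  have "finite \<M>"
    by (rule finite_subset[of _ "Pow (carrier G)"]) (use fin in \<open>auto simp: \<M>_def dest: subgroup.subset\<close>)
  moreover have "A \<in> \<M>" using A by (simp add: \<M>_def)
  ultimately obtain M where M: "M \<in> \<M>" and Mmax: "\<And>L. L \<in> \<M> \<Longrightarrow> M \<subseteq> L \<Longrightarrow> M = L"
    using finite_has_maximal[of \<M>] by blast
  have Msub: "subgroup M G" and AM: "A \<subseteq> M" and Mne: "M \<noteq> carrier G"
    using M by (auto simp: \<M>_def)
  interpret M: subgroup M G by fact
  \<comment> \<open>Find \<open>t \<notin> M\<close> with \<open>t ^ p \<in> M\<close>; then \<open>y \<otimes> t ^ k \<mapsto> k mod p\<close> for \<open>y \<in> M\<close> is the required map.\<close>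
  obtain x where x: "x \<in> carrier G" "x \<notin> M" using Mne M.subset by auto
  have ord: "order G > 0" using fin by (simp add: order_gt_0_iff_finite)
  \<comment> \<open>\<open>n\<close> is the order of \<open>x\<close> modulo \<open>M\<close>, so
    for a prime \<open>p\<close> dividing \<open>n\<close> the power \<open>x [^] (n div p)\<close>
    has order \<open>p\<close> modulo \<open>M\<close>.\<close>
  define n where "n = (LEAST n. n > 0 \<and> x [^] (n::nat) \<in> M)"
  have "\<exists>n. n > 0 \<and> x [^] (n::nat) \<in> M"
    using ord pow_order_eq_1[OF x(1)] M.one_closed by (intro exI[of _ "order G"]) auto
  then have n: "n > 0" "x [^] n \<in> M"
    unfolding n_def using LeastI_ex[of "\<lambda>n. n > 0 \<and> x [^] n \<in> M"] by auto
  have nmin: "n \<le> m" if "0 < m" "x [^] m \<in> M" for m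
    unfolding n_def by (rule Least_le) (use that in blast)
  have "n \<noteq> 1" using n(2) x by (auto)
  then obtain p where p: "Factorial_Ring.prime p" "p dvd n" using prime_factor_nat by blast
  have p1: "p > 1" using p(1) prime_gt_1_nat by blast
  define t where "t = x [^] (n div p)"
  have t: "t \<in> carrier G" using x by (simp add: t_def)
  have tp: "t [^] p \<in> M" using n(2) p(2) x by (simp add: t_def nat_pow_pow)
  have "0 < n div p" "n div p < n" using n p p1 by (auto simp: dvd_div_eq_0_iff intro!: Nat.gr0I)
  then have tM: "t \<notin> M" using nmin[of "n div p"] unfolding t_def by linarith
  \<comment> \<open>Otherwise Bezout expresses \<open>t\<close> through \<open>t [^] k\<close> and
    \<open>t [^] p\<close>, both in \<open>M\<close>. Hence exponents of \<open>t\<close> modulo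
    \<open>M\<close> are determined modulo \<open>p\<close>.\<close>
  have key: "int p dvd k" if k: "t [^] k \<in> M" for k :: int
  proof (rule ccontr)
    assume "\<not> int p dvd k"
    then have "gcd k (int p) = 1"
      using p(1) by (metis coprime_commute coprime_iff_gcd_eq_1 prime_imp_coprime prime_nat_int_transfer)
    then obtain u v where uv: "u * k + v * int p = 1" using bezout_int by metis
    have "t = t [^] (k * u + int p * v)" using uv t by (simp add: mult.commute)
    also have "\<dots> = (t [^] k) [^] u \<otimes> (t [^] int p) [^] v"
      using t by (simp add: int_pow_mult int_pow_pow)
    also have "\<dots> \<in> M"
      using subgroup_int_pow_closed[OF Msub k] subgroup_int_pow_closed[OF Msub, of "t [^] int p"] tp
      by (simp add: int_pow_int)
    finally show False using tM by blast
  qed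
  have pdvd: "p dvd order G"
    using key[of "int (order G)"] pow_order_eq_1[OF t] M.one_closed by (simp add: int_pow_int)
  \<comment> \<open>By maximality of \<open>M\<close>, adjoining \<open>t\<close> gives all of
    \<open>G\<close>, so every element has the form \<open>y \<otimes> t [^] k\<close> with
    \<open>y\<close> in \<open>M\<close>.\<close>
  have "subgroup (M <#> generate G {t}) G"
    using t by (intro mult_subgroups Msub generate_is_subgroup) auto
  moreover have sub: "M \<subseteq> M <#> generate G {t}"
    using generate.one[of G "{t}"] M.subset unfolding set_mult_def by force
  moreover have "\<one> \<otimes> t \<in> M <#> generate G {t}"
    using generate.incl[of t "{t}" G] M.one_closed unfolding set_mult_def by blast
  ultimately have full: "M <#> generate G {t} = carrier G"
    using Mmax[OF _ sub] AM tM by (auto simp: \<M>_def l_one[OF t])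
  have ex: "\<exists>k::int. \<exists>y\<in>M. z = y \<otimes> t [^] k" if "z \<in> carrier G" for z
  proof -
    have "z \<in> M <#> generate G {t}" using that full by simp
    then show ?thesis unfolding set_mult_def generate_pow[OF t] by auto
  qed
  \<comment> \<open>The chosen exponent is arbitrary; \<open>e_eq\<close> shows that its residue
    modulo \<open>p\<close> is not.\<close>
  define e where "e z = (SOME k::int. \<exists>y\<in>M. z = y \<otimes> t [^] k)" for z
  have e: "\<exists>y\<in>M. z = y \<otimes> t [^] e z" if "z \<in> carrier G" for z
    unfolding e_def by (rule someI_ex) (rule ex[OF that])
  have e_eq: "e z mod int p = k mod int p" if "y \<in> M" "z = y \<otimes> t [^] k" for y z and k :: int
  proof -
    have yc: "y \<in> carrier G" using that M.subset by auto
    have zc: "z \<in> carrier G" using that t yc by simp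
    obtain y' where y': "y' \<in> M" "z = y' \<otimes> t [^] e z" using e[OF zc] by blast
    have y'c: "y' \<in> carrier G" using y' M.subset by auto
    have "y' \<otimes> t [^] e z = y \<otimes> t [^] k" using y' that by simp
    then have "t [^] e z = inv y' \<otimes> (y \<otimes> t [^] k)"
      using y'c yc t by (metis inv_solve_left int_pow_closed m_closed)
    then have "t [^] (e z - k) = inv y' \<otimes> y"
      using y'c yc t by (simp add: int_pow_diff m_assoc)
    also have "\<dots> \<in> M" using y' that by simp
    finally show ?thesis using key by (simp add: mod_eq_dvd_iff)
  qed
  define \<phi> where "\<phi> z = e z mod int p" for z
  have "\<phi> \<in> hom G (integer_mod_group p)"
  proof (rule homI)
    show "\<phi> z \<in> carrier (integer_mod_group p)" for z
      using p1 by (auto simp: \<phi>_def carrier_integer_mod_group)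
  next
    fix a b assume ab: "a \<in> carrier G" "b \<in> carrier G"
    obtain y y' where y: "y \<in> M" "a = y \<otimes> t [^] e a" and y': "y' \<in> M" "b = y' \<otimes> t [^] e b"
      using e ab by meson
    have c: "y \<in> carrier G" "y' \<in> carrier G" "t [^] e a \<in> carrier G" "t [^] e b \<in> carrier G"
      using y y' M.subset t by auto
    have "a \<otimes> b = (y \<otimes> t [^] e a) \<otimes> (y' \<otimes> t [^] e b)" using y y' by simp
    also have "\<dots> = (y \<otimes> y') \<otimes> t [^] (e a + e b)"
      using c t by (simp add: int_pow_mult m_ac)
    finally have "e (a \<otimes> b) mod int p = (e a + e b) mod int p"
      using y y' by (intro e_eq[of "y \<otimes> y'"]) auto
    then show "\<phi> (a \<otimes> b) = \<phi> a \<otimes>\<^bsub>integer_mod_group p\<^esub> \<phi> b"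
      by (simp add: \<phi>_def mod_add_eq)
  qed
  moreover have "\<phi> z = 0" if "z \<in> A" for z
    using that AM M.subset e_eq[of z z 0] by (auto simp: \<phi>_def)
  moreover have "\<phi> t \<noteq> 0"
    using p1 t e_eq[of \<one> t 1] M.one_closed by (simp add: \<phi>_def)
  ultimately show thesis using that p(1) pdvd t by blast
qed

lemma character_group_hom:
  assumes "group G" "\<phi> \<in> hom G (integer_mod_group p)"
  shows "group_hom G (integer_mod_group p) \<phi>"
  using assms by (simp add: group_hom_def group_hom_axioms_def)

text \<open>The image is a nontrivial subgroup of a group of prime order, so it has exactly
  \<open>p\<close> elements.\<close>

lemma card_kernel_character:
  assumes G: "group G" and p: "Factorial_Ring.prime p" and \<phi>: "\<phi> \<in> hom G (integer_mod_group p)"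
    and ne: "\<exists>x\<in>carrier G. \<phi> x \<noteq> 0"
  shows "card (kernel G (integer_mod_group p) \<phi>) * p = order G"
proof -
  interpret group_hom G "integer_mod_group p" \<phi> using character_group_hom[OF G \<phi>] .
  have p0: "p > 0" using p prime_gt_0_nat by blast
  have ordp: "order (integer_mod_group p) = p"
    using p0 by (simp add: order_def carrier_integer_mod_group)
  have "subgroup (\<phi> ` carrier G) (integer_mod_group p)" using img_is_subgroup .
  then have "card (\<phi> ` carrier G) dvd p"
    using H.lagrange[of "\<phi> ` carrier G"] by (metis dvd_triv_right ordp)
  moreover have "card (\<phi> ` carrier G) \<noteq> 1"
  proof
    assume "card (\<phi> ` carrier G) = 1"
    then obtain c where "\<phi> ` carrier G = {c}" by (auto simp: card_1_singleton_iff)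
    moreover have "0 \<in> \<phi> ` carrier G" using hom_one by (metis G.one_closed image_eqI one_integer_mod_group)
    ultimately show False using ne by auto
  qed
  ultimately have "card (\<phi> ` carrier G) = p" using p by (metis prime_nat_iff)
  then show ?thesis using card_kernel_mult_card_image by simp
qed

section \<open>Counting non-generating tuples, and a lower bound\<close>

text \<open>Tuples are extensional functions because, for a finite group, these form the support of
  the \<open>Pi_pmf\<close> in \<open>gen_prob\<close>, whose default is \<open>undefined\<close>;
  probabilities become ratios of cardinalities.\<close>

definition nongen :: "nat \<Rightarrow> ('a, 'x) monoid_scheme \<Rightarrow> (nat \<Rightarrow> 'a) set" where
  "nongen k G = {Z \<in> {..<k} \<rightarrow>\<^sub>E carrier G. generate G (Z ` {..<k}) \<noteq> carrier G}"

lemma finite_nongen: "finite (carrier G) \<Longrightarrow> finite (nongen k G)"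
  by (rule finite_subset[of _ "{..<k} \<rightarrow>\<^sub>E carrier G"]) (auto simp: nongen_def intro: finite_PiE)

lemma gen_prob_nongen:
  assumes G: "group G" and fin: "finite (carrier G)"
  shows "gen_prob k G = 1 - card (nongen k G) / real (order G) ^ k"
proof -
  let ?T = "{..<k} \<rightarrow>\<^sub>E carrier G"
  have ne: "carrier G \<noteq> {}" using G by (simp add: group.is_monoid monoid.carrier_not_empty)
  have T: "PiE_dflt {..<k} undefined (\<lambda>_. carrier G) = ?T"
    by (auto simp: PiE_dflt_def PiE_def extensional_def)
  have finT: "finite ?T" using fin by (intro finite_PiE) auto
  have cT: "card ?T = order G ^ k" by (simp add: card_PiE order_def)
  have "?T \<noteq> {}" using ne by (simp add: PiE_eq_empty_iff)
  then have "gen_prob k G = card (?T \<inter> {Z. generate G (Z ` {..<k}) = carrier G}) / card ?T"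
    unfolding gen_prob_def using fin ne finT
    by (subst Pi_pmf_of_set) (auto simp: T measure_pmf_of_set)
  also have "?T \<inter> {Z. generate G (Z ` {..<k}) = carrier G} = ?T - nongen k G"
    by (auto simp: nongen_def)
  also have "card (?T - nongen k G) = card ?T - card (nongen k G)"
    by (rule card_Diff_subset) (use fin in \<open>auto simp: nongen_def intro: finite_nongen[unfolded nongen_def]\<close>)
  also have "real \<dots> = real (card ?T) - card (nongen k G)"
    by (rule of_nat_diff) (use finT in \<open>auto simp: nongen_def intro: card_mono\<close>)
  finally show ?thesis
    using fin cT G by (simp add: diff_divide_distrib monoid.order_gt_0_iff_finite group.is_monoid)
qed

text \<open>For \<open>k < min_gens H\<close> the truncated exponent is \<open>0\<close>: no \<open>k\<close>-tuple generates \<open>G\<close>.\<close>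

lemma card_nongen_ge:
  assumes G: "comm_group G" "finite (carrier G)" and H: "finite_abelian_p_group p H" "order H \<noteq> 1"
    and \<pi>: "\<pi> \<in> hom G H" "\<pi> ` carrier G = carrier H"
  shows "order G ^ k \<le> card (nongen k G) * p ^ (k + 1 - min_gens H)"
proof -
  interpret G: comm_group G by fact
  interpret H: comm_group H using H by (simp add: finite_abelian_p_group_def)
  interpret \<pi>: group_hom G H \<pi> using \<pi> by unfold_locales
  have p: "Factorial_Ring.prime p" using H by (simp add: finite_abelian_p_group_def)
  obtain n where n: "order H = p ^ n" using H by (auto simp: finite_abelian_p_group_def)
  have finH: "finite (carrier H)" using \<pi>(2) G(2) by (metis finite_imageI)
  have "min_gens H \<noteq> 0"
  proof
    assume "min_gens H = 0"
    moreover obtain S where "finite S" "card S = min_gens H" "generate H S = carrier H"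
      using H.obtain_min_gens[OF finH] .
    ultimately have "generate H {} = carrier H" by simp
    then have "carrier H = {\<one>\<^bsub>H\<^esub>}" using H.generate_empty by simp
    with H(2) show False by (simp add: order_def)
  qed
  \<comment> \<open>The first \<open>j\<close> entries are too few for their images to generate
    \<open>H\<close>. Since \<open>min_gens H\<close> is positive, subtracting 1 is exact, and the
    cap at \<open>k\<close> covers short tuples.\<close>
  define j where "j = min k (min_gens H - 1)"
  have jk: "j \<le> k" "j < min_gens H" "k - j = k + 1 - min_gens H"
    using \<open>min_gens H \<noteq> 0\<close> by (auto simp: j_def)
  let ?U = "{..<j} \<rightarrow>\<^sub>E carrier G"
  have "\<exists>M. subgroup M G \<and> M \<noteq> carrier G \<and> u ` {..<j} \<subseteq> M \<and> card M * p = order G" if u: "u \<in> ?U" for u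
  proof -
    let ?S = "(\<pi> \<circ> u) ` {..<j}"
    have uc: "u i \<in> carrier G" if "i < j" for i using u that by auto
    have S: "?S \<subseteq> carrier H" using uc \<pi>.hom_closed by auto
    have "card ?S < min_gens H" using card_image_le[of "{..<j}" "\<pi> \<circ> u"] jk by simp
    then have "generate H ?S \<noteq> carrier H" using H.min_gens_le_card[OF S] by auto
    then obtain q \<phi> where q: "Factorial_Ring.prime q" "q dvd order H" and
      \<phi>: "\<phi> \<in> hom H (integer_mod_group q)" "\<And>x. x \<in> generate H ?S \<Longrightarrow> \<phi> x = 0" "\<exists>x\<in>carrier H. \<phi> x \<noteq> 0"
      using H.proper_subgroup_character[OF finH H.generate_is_subgroup[OF S]] by metis
    \<comment> \<open>The character found on \<open>H\<close> has some prime modulus dividing the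
      order of \<open>H\<close>, which is a power of \<open>p\<close>.\<close>
    have "q = p" using q p n by (metis prime_dvd_power primes_dvd_imp_eq)
    have hom: "\<phi> \<circ> \<pi> \<in> hom G (integer_mod_group p)"
      using hom_compose[OF \<pi>(1) \<phi>(1)] \<open>q = p\<close> by (simp add: o_def)
    have ne: "\<exists>x\<in>carrier G. (\<phi> \<circ> \<pi>) x \<noteq> 0"
      using \<phi>(3) unfolding \<pi>(2)[symmetric] by auto
    let ?M = "kernel G (integer_mod_group p) (\<phi> \<circ> \<pi>)"
    have "subgroup ?M G"
      using group_hom.subgroup_kernel[OF character_group_hom[OF G.group_axioms hom]] .
    moreover have "?M \<noteq> carrier G" using ne by (auto simp: kernel_def)
    moreover have "u ` {..<j} \<subseteq> ?M"
      using uc \<phi>(2) by (auto simp: kernel_def intro!: generate.incl)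
    moreover have "card ?M * p = order G"
      by (rule card_kernel_character[OF G.group_axioms p hom ne])
    ultimately show ?thesis by blast
  qed
  then obtain M where M: "\<And>u. u \<in> ?U \<Longrightarrow> subgroup (M u) G" "\<And>u. u \<in> ?U \<Longrightarrow> M u \<noteq> carrier G"
    "\<And>u. u \<in> ?U \<Longrightarrow> u ` {..<j} \<subseteq> M u" "\<And>u. u \<in> ?U \<Longrightarrow> card (M u) * p = order G"
    by metis
  have Mc: "M u \<subseteq> carrier G" if "u \<in> ?U" for u using M(1)[OF that] by (simp add: subgroup.subset)
  \<comment> \<open>Pairs of an arbitrary prefix \<open>u\<close> and a tail inside its subgroup
    \<open>M u\<close> are glued into tuples that stay in \<open>M u\<close>, hence do not
    generate.\<close>
  let ?A = "Sigma ?U (\<lambda>u. {j..<k} \<rightarrow>\<^sub>E M u)"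
  let ?F = "\<lambda>(u, v) i. if i < j then u i else v i :: 'a"
  have "inj_on ?F ?A"
  proof (rule inj_onI, clarify)
    fix u v u' v'
    assume *: "u \<in> ?U" "u' \<in> ?U" "v \<in> {j..<k} \<rightarrow>\<^sub>E M u" "v' \<in> {j..<k} \<rightarrow>\<^sub>E M u'"
      and eq: "(\<lambda>i. if i < j then u i else v i) = (\<lambda>i. if i < j then u' i else v' i)"
    have "u i = u' i" for i
      using fun_cong[OF eq, of i] * by (cases "i < j") (auto simp: PiE_def extensional_def)
    moreover have "v i = v' i" for i
      using fun_cong[OF eq, of i] * by (cases "i < j") (auto simp: PiE_def extensional_def)
    ultimately show "u = u' \<and> v = v'" by auto
  qed
  moreover have "?F ` ?A \<subseteq> nongen k G"
  proof clarify
    fix u v assume u: "u \<in> ?U" and v: "v \<in> {j..<k} \<rightarrow>\<^sub>E M u"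
    let ?Z = "\<lambda>i. if i < j then u i else v i"
    have Z: "?Z i \<in> M u" if "i < k" for i using M(3)[OF u] v that by auto
    then have "?Z ` {..<k} \<subseteq> M u" by blast
    then have "generate G (?Z ` {..<k}) \<subseteq> M u"
      using M(1)[OF u] by (rule G.generate_subgroup_incl)
    then have "generate G (?Z ` {..<k}) \<noteq> carrier G" using M(2)[OF u] Mc[OF u] by auto
    moreover have "?Z \<in> {..<k} \<rightarrow>\<^sub>E carrier G"
    proof (rule PiE_I)
      show "?Z i \<in> carrier G" if "i \<in> {..<k}" for i using Z[of i] Mc[OF u] that by blast
      show "?Z i = undefined" if "i \<notin> {..<k}" for i
        using v jk(1) that by (auto simp: PiE_iff extensional_def)
    qed
    ultimately show "?Z \<in> nongen k G" by (simp add: nongen_def)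
  qed
  ultimately have "card ?A \<le> card (nongen k G)"
    using card_inj_on_le finite_nongen[OF G(2)] by blast
  moreover have "card ?A = (\<Sum>u\<in>?U. card (M u) ^ (k - j))"
    using G(2) Mc by (subst card_SigmaI) (auto intro!: finite_PiE dest: finite_subset simp: card_PiE)
  ultimately have "(\<Sum>u\<in>?U. card (M u) ^ (k - j)) * p ^ (k - j) \<le> card (nongen k G) * p ^ (k - j)"
    by simp
  \<comment> \<open>Each \<open>M u\<close> has index \<open>p\<close>, so a factor \<open>p\<close>
    for each of the \<open>k - j\<close> tail entries restores the count of unrestricted
    tails.\<close>
  also have "(\<Sum>u\<in>?U. card (M u) ^ (k - j)) * p ^ (k - j) = (\<Sum>u\<in>?U. order G ^ (k - j))"
    unfolding sum_distrib_right using M(4) by (intro sum.cong) (auto simp flip: power_mult_distrib)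
  also have "\<dots> = order G ^ k"
    using jk(1) by (simp add: card_PiE order_def flip: power_add)
  finally show ?thesis using jk(3) by simp
qed

section \<open>Counting characters and the tuples they kill\<close>

text \<open>Extensionality makes this set finite and lets characters be compared on \<open>carrier G\<close> alone.\<close>

abbreviation characters :: "nat \<Rightarrow> ('a, 'x) monoid_scheme \<Rightarrow> ('a \<Rightarrow> int) set" where
  "characters p G \<equiv> hom G (integer_mod_group p) \<inter> extensional (carrier G)"

lemma finite_characters:
  assumes "finite (carrier G)" "p > 0"
  shows "finite (characters p G)"
proof (rule finite_subset)
  show "characters p G \<subseteq> carrier G \<rightarrow>\<^sub>E {0..<int p}"
    using assms by (auto simp: hom_def carrier_integer_mod_group PiE_def)
qed (use assms in \<open>auto intro: finite_PiE\<close>)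

text \<open>A character is determined by its values on lifts of a minimal generating set of
  \<open>H\<close>, with \<open>p\<close> choices for each value. Coprimality is what forces
  characters to vanish on the kernel of \<open>\<pi>\<close>.\<close>

lemma card_characters_le:
  assumes G: "group G" "finite (carrier G)" and H: "group H"
    and \<pi>: "\<pi> \<in> hom G H" "\<pi> ` carrier G = carrier H"
    and p: "p > 0" and cop: "coprime p (card (kernel G H \<pi>))"
  shows "card (characters p G) \<le> p ^ min_gens H"
proof -
  interpret G: group G by fact
  interpret H: group H by fact
  interpret \<pi>: group_hom G H \<pi> using \<pi> by unfold_locales
  have finH: "finite (carrier H)" using \<pi>(2) G(2) by (metis finite_imageI)
  obtain S where S: "S \<subseteq> carrier H" "finite S" "card S = min_gens H" "generate H S = carrier H"
    using H.obtain_min_gens[OF finH] .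
  define s where "s = inv_into (carrier G) \<pi>"
  have s: "s y \<in> carrier G" "\<pi> (s y) = y" if "y \<in> S" for y
    using that S(1) unfolding \<pi>(2)[symmetric] s_def by (auto intro: inv_into_into f_inv_into_f)
  \<comment> \<open>Characters kill the kernel of \<open>\<pi>\<close>, so they are determined by their values on lifts of
    generators of \<open>H\<close>.\<close>
  have kill: "\<phi> x = 0" if \<phi>: "\<phi> \<in> characters p G" and x: "x \<in> kernel G H \<pi>" for \<phi> x
  proof -
    interpret \<phi>: group_hom G "integer_mod_group p" \<phi>
      using character_group_hom[OF G(1)] \<phi> by blast
    have xc: "x \<in> carrier G" using x by (simp add: kernel_def)
    interpret K: group "G\<lparr>carrier := kernel G H \<pi>\<rparr>"
      using G.subgroup_imp_group[OF \<pi>.subgroup_kernel] .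
    let ?m = "card (kernel G H \<pi>)"
    \<comment> \<open>The order \<open>?m\<close> of the kernel annihilates \<open>x\<close>, so
      \<open>?m\<close> times \<open>\<phi> x\<close> vanishes modulo \<open>p\<close>, and
      \<open>?m\<close> can be cancelled.\<close>
    have "x [^]\<^bsub>G\<^esub> ?m = \<one>\<^bsub>G\<^esub>"
      using K.pow_order_eq_1[of x] x by (simp add: order_def flip: G.nat_pow_consistent)
    then have "\<phi> (x [^]\<^bsub>G\<^esub> ?m) = 0" by simp
    then have "(int ?m * \<phi> x) mod int p = 0" using xc by (simp add: \<phi>.hom_nat_pow)
    then have "int p dvd int ?m * \<phi> x" by auto
    then have "int p dvd \<phi> x" using cop
      by (metis coprime_dvd_mult_right_iff coprime_int_iff)
    moreover have "\<phi> x \<in> {0..<int p}" using \<phi>.hom_closed[OF xc] p by (simp add: carrier_integer_mod_group)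
    ultimately show ?thesis by (metis atLeastLessThan_iff dvd_imp_mod_0 mod_pos_pos_trivial)
  qed
  let ?R = "\<lambda>\<phi>. restrict (\<phi> \<circ> s) S"
  have "inj_on ?R (characters p G)"
  proof (rule inj_onI)
    fix \<phi> \<psi> assume *: "\<phi> \<in> characters p G" "\<psi> \<in> characters p G" "?R \<phi> = ?R \<psi>"
    interpret \<phi>: group_hom G "integer_mod_group p" \<phi>
      using character_group_hom[OF G(1)] * by blast
    interpret \<psi>: group_hom G "integer_mod_group p" \<psi>
      using character_group_hom[OF G(1)] * by blast
    \<comment> \<open>The equalizer of the two characters contains the lifts, so it maps onto
      \<open>H\<close>. Any \<open>x\<close> thus differs from an element of \<open>D\<close> by a
      kernel element, which also lies in \<open>D\<close>.\<close>
    define D where "D = {x \<in> carrier G. \<phi> x = \<psi> x}"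
    have D: "subgroup D G" unfolding D_def by unfold_locales auto
    have eq: "\<phi> (s y) = \<psi> (s y)" if "y \<in> S" for y
      using fun_cong[OF *(3), of y] that by simp
    have sD: "s ` S \<subseteq> D" using eq s(1) unfolding D_def by blast
    have sS: "s ` S \<subseteq> carrier G" using s(1) by blast
    have "\<pi> ` s ` S = S" using s(2) by (simp add: image_image cong: image_cong)
    then have sub: "carrier H = \<pi> ` generate G (s ` S)"
      using \<pi>.generate_img[OF sS] S(4) by simp
    have "\<phi> x = \<psi> x" if x: "x \<in> carrier G" for x
    proof -
      have "\<pi> x \<in> \<pi> ` generate G (s ` S)" using \<pi>.hom_closed[OF x] sub by simp
      then obtain d where d: "d \<in> D" "\<pi> x = \<pi> d"
        using G.generate_subgroup_incl[OF sD D] by blast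
      have dc: "d \<in> carrier G" using d(1) by (simp add: D_def)
      let ?y = "inv\<^bsub>G\<^esub> d \<otimes>\<^bsub>G\<^esub> x"
      have "?y \<in> kernel G H \<pi>" using d(2) dc x by (simp add: kernel_def)
      then have "\<phi> ?y = 0" "\<psi> ?y = 0" using kill *(1,2) by auto
      then have "?y \<in> D" using dc x by (simp add: D_def)
      then have "d \<otimes>\<^bsub>G\<^esub> ?y \<in> D" using d(1) subgroup.m_closed[OF D] by blast
      moreover have "d \<otimes>\<^bsub>G\<^esub> ?y = x" using dc x by (simp flip: G.m_assoc)
      ultimately show ?thesis by (simp add: D_def)
    qed
    then show "\<phi> = \<psi>" using * by (intro extensionalityI[of _ "carrier G"]) auto
  qed
  moreover have "?R ` characters p G \<subseteq> S \<rightarrow>\<^sub>E {0..<int p}"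
    using s(1) p by (auto simp: hom_def Pi_iff carrier_integer_mod_group)
  ultimately have "card (characters p G) \<le> card (S \<rightarrow>\<^sub>E {0..<int p})"
    using S(2) by (intro card_inj_on_le[of ?R] finite_PiE) auto
  then show ?thesis using S(2,3) by (simp add: card_PiE)
qed

text \<open>For a finite abelian group and prime \<open>p\<close>, these are the tuples whose images
  fail to generate the quotient of \<open>G\<close> by its \<open>p\<close>-th powers.\<close>

definition killed_tuples :: "nat \<Rightarrow> nat \<Rightarrow> ('a, 'x) monoid_scheme \<Rightarrow> (nat \<Rightarrow> 'a) set" where
  "killed_tuples p k G = {Z \<in> {..<k} \<rightarrow>\<^sub>E carrier G.
     \<exists>\<phi>\<in>characters p G. (\<exists>x\<in>carrier G. \<phi> x \<noteq> 0) \<and> (\<forall>i<k. \<phi> (Z i) = 0)}"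

text \<open>Scalar multiples supply the \<open>p - 1\<close> nonzero characters that kill the same
  tuple in the next count.\<close>

lemma character_multiple:
  assumes G: "group G" and p: "p > 0" and \<phi>: "\<phi> \<in> characters p G"
  shows "(\<lambda>x\<in>carrier G. c * \<phi> x mod int p) \<in> characters p G"
proof -
  interpret group G by fact
  have "\<phi> (x \<otimes>\<^bsub>G\<^esub> y) = (\<phi> x + \<phi> y) mod int p" if "x \<in> carrier G" "y \<in> carrier G" for x y
    using that \<phi> by (simp add: hom_def)
  then show ?thesis
    using p by (auto simp: hom_def carrier_integer_mod_group mod_simps distrib_left)
qed

text \<open>Double counting of pairs of a tuple and a nonzero character killing it: each killed
  tuple meets at least \<open>p - 1\<close> such characters, while each character kills at most a
  fraction \<open>1 / p ^ k\<close> of all tuples, its kernel having index \<open>p\<close>.\<close>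

lemma card_killed_tuples_le:
  assumes G: "group G" and fin: "finite (carrier G)" and p: "Factorial_Ring.prime p"
  shows "card (killed_tuples p k G) * (p - 1) * p ^ k \<le> card (characters p G) * order G ^ k"
proof -
  interpret group G by fact
  have p0: "p > 0" using p prime_gt_0_nat by blast
  define X where "X = {\<phi> \<in> characters p G. \<exists>x\<in>carrier G. \<phi> x \<noteq> 0}"
  let ?E = "killed_tuples p k G"
  let ?k = "\<lambda>Z \<phi>. \<forall>i<k. \<phi> (Z i) = (0::int)"
  have finX: "finite X" using finite_characters[OF fin p0] unfolding X_def by (rule finite_subset[rotated]) blast
  have finE: "finite ?E"
    by (rule finite_subset[of _ "{..<k} \<rightarrow>\<^sub>E carrier G"])
      (use fin in \<open>auto simp: killed_tuples_def intro: finite_PiE\<close>)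
  have lower: "p - 1 \<le> card {\<phi> \<in> X. ?k Z \<phi>}" if Z: "Z \<in> ?E" for Z
  proof -
    obtain \<phi> x where \<phi>: "\<phi> \<in> characters p G" "?k Z \<phi>" and x: "x \<in> carrier G" "\<phi> x \<noteq> 0"
      using Z by (auto simp: killed_tuples_def)
    let ?m = "\<lambda>c. \<lambda>x\<in>carrier G. c * \<phi> x mod int p"
    have Zc: "Z i \<in> carrier G" if "i < k" for i using Z that by (auto simp: killed_tuples_def)
    have "\<phi> x \<in> {0..<int p}" using \<phi>(1) x(1) p0 by (auto simp: hom_def carrier_integer_mod_group)
    then have "\<not> int p dvd \<phi> x" using x(2) by (auto dest: zdvd_imp_le)
    then have cop: "coprime (\<phi> x) (int p)"
      using p by (metis coprime_commute prime_imp_coprime prime_nat_int_transfer)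
    have key: "c = c'" if "c \<in> {0..<int p}" "c' \<in> {0..<int p}" "?m c = ?m c'" for c c'
    proof -
      have "c * \<phi> x mod int p = c' * \<phi> x mod int p" using fun_cong[OF that(3), of x] x(1) by simp
      then have "int p dvd (c - c') * \<phi> x" by (simp add: mod_eq_dvd_iff left_diff_distrib)
      then have "int p dvd c - c'" using cop by (simp add: coprime_commute coprime_dvd_mult_left_iff)
      then have "c mod int p = c' mod int p" by (simp add: mod_eq_dvd_iff)
      then show ?thesis using that by simp
    qed
    have "inj_on ?m {1..<int p}" by (rule inj_onI) (rule key, auto)
    moreover have "?m ` {1..<int p} \<subseteq> {\<phi> \<in> X. ?k Z \<phi>}"
    proof clarify
      fix c assume c: "c \<in> {1..<int p}"
      have "c * \<phi> x mod int p \<noteq> 0"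
        using key[of c 0] c cop by (auto simp: coprime_commute coprime_dvd_mult_left_iff dest: zdvd_imp_le)
      then show "?m c \<in> X \<and> ?k Z (?m c)"
        using character_multiple[OF G p0 \<phi>(1), of c] \<phi>(2) x(1) Zc
        by (auto simp: X_def intro!: bexI[of _ x])
    qed
    ultimately have "card {1..<int p} \<le> card {\<phi> \<in> X. ?k Z \<phi>}"
      using finX by (intro card_inj_on_le[of ?m]) auto
    then show ?thesis by simp
  qed
  have upper: "card {Z \<in> ?E. ?k Z \<phi>} * p ^ k \<le> order G ^ k" if \<phi>: "\<phi> \<in> X" for \<phi>
  proof -
    let ?K = "kernel G (integer_mod_group p) \<phi>"
    have finK: "finite ?K" using fin by (simp add: kernel_def)
    have "{Z \<in> ?E. ?k Z \<phi>} \<subseteq> {..<k} \<rightarrow>\<^sub>E ?K"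
      by (auto simp: killed_tuples_def kernel_def PiE_iff extensional_def)
    then have "card {Z \<in> ?E. ?k Z \<phi>} \<le> card ({..<k} \<rightarrow>\<^sub>E ?K)"
      using finK by (intro card_mono finite_PiE) auto
    then have "card {Z \<in> ?E. ?k Z \<phi>} * p ^ k \<le> (card ?K * p) ^ k"
      by (simp add: card_PiE power_mult_distrib)
    also have "card ?K * p = order G"
      using \<phi> by (intro card_kernel_character[OF G p]) (auto simp: X_def)
    finally show ?thesis .
  qed
  have "card ?E * (p - 1) = (\<Sum>Z\<in>?E. p - 1)" by simp
  also have "\<dots> \<le> (\<Sum>Z\<in>?E. card {\<phi> \<in> X. ?k Z \<phi>})" by (rule sum_mono) (rule lower)
  also have "\<dots> = (\<Sum>Z\<in>?E. \<Sum>\<phi>\<in>{\<phi> \<in> X. ?k Z \<phi>}. 1)" by simp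
  also have "\<dots> = (\<Sum>\<phi>\<in>X. \<Sum>Z\<in>{Z \<in> ?E. ?k Z \<phi>}. 1)"
    by (rule sum.swap_restrict[OF finE finX])
  also have "\<dots> = (\<Sum>\<phi>\<in>X. card {Z \<in> ?E. ?k Z \<phi>})" by simp
  finally have "card ?E * (p - 1) * p ^ k \<le> (\<Sum>\<phi>\<in>X. card {Z \<in> ?E. ?k Z \<phi>}) * p ^ k" by simp
  also have "\<dots> = (\<Sum>\<phi>\<in>X. card {Z \<in> ?E. ?k Z \<phi>} * p ^ k)" by (simp add: sum_distrib_right)
  also have "\<dots> \<le> (\<Sum>\<phi>\<in>X. order G ^ k)" by (rule sum_mono) (rule upper)
  also have "\<dots> = card X * order G ^ k" by simp
  also have "card X \<le> card (characters p G)"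
    using finite_characters[OF fin p0] by (intro card_mono) (auto simp: X_def)
  finally show ?thesis by simp
qed

text \<open>Some character vanishes on the proper subgroup generated by the tuple. Keeping only
  primes that divide the order later confines the union to \<open>P\<close>.\<close>

lemma nongen_subset_killed_tuples:
  assumes G: "comm_group G" "finite (carrier G)"
  shows "nongen k G \<subseteq> (\<Union>p\<in>{p. Factorial_Ring.prime p \<and> p dvd order G}. killed_tuples p k G)"
proof
  interpret comm_group G by fact
  fix Z assume "Z \<in> nongen k G"
  then have Z: "Z \<in> {..<k} \<rightarrow>\<^sub>E carrier G" "generate G (Z ` {..<k}) \<noteq> carrier G"
    by (auto simp: nongen_def)
  then have ZG: "Z ` {..<k} \<subseteq> carrier G" by auto
  obtain p \<phi> where p: "Factorial_Ring.prime p" "p dvd order G"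
    and \<phi>: "\<phi> \<in> hom G (integer_mod_group p)" "\<And>x. x \<in> generate G (Z ` {..<k}) \<Longrightarrow> \<phi> x = 0"
      "\<exists>x\<in>carrier G. \<phi> x \<noteq> 0"
    using proper_subgroup_character[OF G(2) generate_is_subgroup[OF ZG] Z(2)] by metis
  have "restrict \<phi> (carrier G) \<in> characters p G"
    using \<phi>(1) by (auto simp: hom_def Pi_iff)
  moreover have "restrict \<phi> (carrier G) (Z i) = 0" if "i < k" for i
  proof -
    have "Z i \<in> carrier G" "Z i \<in> generate G (Z ` {..<k})"
      using that ZG by (auto intro: generate.incl)
    then show ?thesis using \<phi>(2) by simp
  qed
  moreover have "\<exists>x\<in>carrier G. restrict \<phi> (carrier G) x \<noteq> 0" using \<phi>(3) by auto
  ultimately have "Z \<in> killed_tuples p k G" using Z(1) unfolding killed_tuples_def by blast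
  with p show "Z \<in> (\<Union>p\<in>{p. Factorial_Ring.prime p \<and> p dvd order G}. killed_tuples p k G)" by blast
qed

section \<open>Primary components and bounds for a single group\<close>

context
  fixes G :: "('a, 'x) monoid_scheme" and P :: "nat set" and H :: "nat \<Rightarrow> ('b, 'y) monoid_scheme"
  assumes G: "comm_group G" "finite (carrier G)" and dec: "primary_decomposition G P H"
begin

lemma primary_component:
  assumes "p \<in> P"
  shows "Factorial_Ring.prime p" "finite_abelian_p_group p (H p)" "order (H p) \<noteq> 1" "group (H p)"
    "order (H p) \<noteq> 0"
proof -
  show *: "Factorial_Ring.prime p" "finite_abelian_p_group p (H p)" "order (H p) \<noteq> 1" "group (H p)"
    using dec assms
    by (auto simp: primary_decomposition_def finite_abelian_p_group_def comm_group_def)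
  show "order (H p) \<noteq> 0"
    using *(1,2) by (auto simp: finite_abelian_p_group_def prime_gt_0_nat)
qed

lemma order_primary_decomposition: "order G = (\<Prod>q\<in>P. order (H q))"
proof -
  have finP: "finite P" using dec by (simp add: primary_decomposition_def)
  have "order G = card (carrier (sum_group P H))"
    using dec by (simp add: primary_decomposition_def order_def iso_same_card)
  also have "carrier (sum_group P H) = (\<Pi>\<^sub>E i\<in>P. carrier (H i))"
    using finP by (subst carrier_sum_group) (auto simp: primary_component)
  finally show ?thesis using finP by (simp add: card_PiE order_def)
qed

text \<open>The isomorphism is followed by the coordinate map. The order of the kernel is the
  product of the orders of the other components, all powers of primes different from
  \<open>p\<close>.\<close>

lemma primary_projection:
  assumes p: "p \<in> P"
  obtains \<pi> where "\<pi> \<in> hom G (H p)" "\<pi> ` carrier G = carrier (H p)"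
    "coprime p (card (kernel G (H p) \<pi>))"
proof -
  have finP: "finite P" using dec by (simp add: primary_decomposition_def)
  obtain h where h: "h \<in> iso G (sum_group P H)"
    using dec by (auto simp: primary_decomposition_def is_iso_def)
  have cs: "carrier (sum_group P H) = (\<Pi>\<^sub>E i\<in>P. carrier (H i))"
    using finP by (subst carrier_sum_group) (auto simp: primary_component)
  have "(\<lambda>f. f p) \<in> hom (sum_group P H) (H p)"
    using p by (auto simp: hom_def cs)
  moreover have "h \<in> hom G (sum_group P H)" using h by (simp add: iso_def)
  ultimately have hom: "(\<lambda>f. f p) \<circ> h \<in> hom G (H p)" using hom_compose by blast
  have "h ` carrier G = (\<Pi>\<^sub>E i\<in>P. carrier (H i))" using h by (simp add: iso_def bij_betw_def cs)
  moreover have "(\<Pi>\<^sub>E i\<in>P. carrier (H i)) \<noteq> {}"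
    using primary_component(4) by (auto simp: PiE_eq_empty_iff group.is_monoid monoid.carrier_not_empty)
  ultimately have img: "((\<lambda>f. f p) \<circ> h) ` carrier G = carrier (H p)"
    using p by (simp only: image_comp[symmetric]) (simp add: image_projection_PiE)
  let ?K = "kernel G (H p) ((\<lambda>f. f p) \<circ> h)"
  interpret group_hom G "H p" "(\<lambda>f. f p) \<circ> h"
    using hom G(1) primary_component(4)[OF p]
    by (simp add: group_hom_def group_hom_axioms_def comm_group_def)
  have "card ?K * order (H p) = order (H p) * (\<Prod>q\<in>P - {p}. order (H q))"
    using card_kernel_mult_card_image order_primary_decomposition prod.remove[OF finP p]
    unfolding img order_def[of "H p", symmetric] by metis
  then have "card ?K = (\<Prod>q\<in>P - {p}. order (H q))" using primary_component(5)[OF p] by simp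
  moreover have "coprime p (order (H q))" if q: "q \<in> P - {p}" for q
  proof -
    have "Factorial_Ring.prime q" "q \<noteq> p" using q primary_component(1) by auto
    moreover obtain n where "order (H q) = q ^ n"
      using q primary_component(2)[of q] unfolding finite_abelian_p_group_def by blast
    ultimately show ?thesis using primary_component(1)[OF p] by (simp add: primes_coprime)
  qed
  ultimately have "coprime p (card ?K)" by (metis (no_types, lifting) prod_coprime_right)
  with hom img that show thesis by blast
qed

text \<open>This makes the natural-number difference \<open>min_gens G - min_gens (H p)\<close>
  exact in part (ii).\<close>

lemma primary_min_gens_le:
  assumes "p \<in> P"
  shows "min_gens (H p) \<le> min_gens G"
proof -
  obtain \<pi> where \<pi>: "\<pi> \<in> hom G (H p)" "\<pi> ` carrier G = carrier (H p)"
    using primary_projection[OF assms] .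
  then interpret group_hom G "H p" \<pi>
    using G(1) primary_component(4)[OF assms]
    by (simp add: group_hom_def group_hom_axioms_def comm_group_def)
  show ?thesis by (rule min_gens_surj_le[OF G(2) \<pi>(2)])
qed

lemma gen_prob_le:
  assumes p: "p \<in> P"
  shows "gen_prob k G \<le> 1 - 1 / real p ^ (k + 1 - min_gens (H p))"
proof -
  interpret comm_group G by (fact G)
  obtain \<pi> where \<pi>: "\<pi> \<in> hom G (H p)" "\<pi> ` carrier G = carrier (H p)"
    using primary_projection[OF p] .
  let ?e = "k + 1 - min_gens (H p)"
  have p0: "real p ^ ?e > 0" using primary_component(1)[OF p] prime_gt_0_nat by simp
  have o: "order G > 0" using G(2) by (simp add: order_gt_0_iff_finite)
  have "order G ^ k \<le> card (nongen k G) * p ^ ?e"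
    using card_nongen_ge[OF G primary_component(2,3)[OF p] \<pi>] .
  then have "real (order G) ^ k \<le> real (card (nongen k G)) * real p ^ ?e"
    by (metis of_nat_le_iff of_nat_mult of_nat_power)
  then have "1 / real p ^ ?e \<le> card (nongen k G) / real (order G) ^ k"
    using p0 o by (simp add: field_simps)
  then show ?thesis using gen_prob_nongen[OF is_group G(2)] by simp
qed

text \<open>A union bound over \<open>P\<close>: the double count bounds each set of killed tuples
  in terms of the number of characters, itself at most \<open>p ^ min_gens (H p)\<close>.\<close>

lemma gen_prob_ge:
  "gen_prob k G \<ge> 1 - (\<Sum>p\<in>P. real p ^ min_gens (H p) / ((real p - 1) * real p ^ k))"
proof -
  interpret comm_group G by (fact G)
  have finP: "finite P" using dec by (simp add: primary_decomposition_def)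
  have o: "order G > 0" using G(2) by (simp add: order_gt_0_iff_finite)
  have in_P: "p \<in> P" if "Factorial_Ring.prime p" "p dvd order G" for p
  proof -
    have "\<exists>q\<in>P. p dvd order (H q)"
      using that finP by (simp add: order_primary_decomposition prime_dvd_prod_iff)
    then obtain q where q: "q \<in> P" "p dvd order (H q)" by blast
    then obtain n where "order (H q) = q ^ n"
      using primary_component(2)[of q] unfolding finite_abelian_p_group_def by blast
    then have "p = q" using q that(1) primary_component(1)[OF q(1)]
      by (metis prime_dvd_power primes_dvd_imp_eq)
    then show ?thesis using q by simp
  qed
  have fink: "finite (killed_tuples p k G)" for p
    by (rule finite_subset[of _ "{..<k} \<rightarrow>\<^sub>E carrier G"])
      (use G in \<open>auto simp: killed_tuples_def intro: finite_PiE\<close>)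
  have "nongen k G \<subseteq> (\<Union>p\<in>P. killed_tuples p k G)"
    using nongen_subset_killed_tuples[OF G] in_P by blast
  then have "card (nongen k G) \<le> card (\<Union>p\<in>P. killed_tuples p k G)"
    using finP fink by (intro card_mono) auto
  also have "\<dots> \<le> (\<Sum>p\<in>P. card (killed_tuples p k G))" by (rule card_UN_le[OF finP])
  finally have "card (nongen k G) / real (order G) ^ k
      \<le> (\<Sum>p\<in>P. card (killed_tuples p k G)) / real (order G) ^ k"
    by (intro divide_right_mono) (auto simp del: of_nat_sum)
  also have "\<dots> = (\<Sum>p\<in>P. card (killed_tuples p k G) / real (order G) ^ k)"
    by (simp add: sum_divide_distrib)
  also have "\<dots> \<le> (\<Sum>p\<in>P. real p ^ min_gens (H p) / ((real p - 1) * real p ^ k))"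
  proof (rule sum_mono)
    fix p assume p: "p \<in> P"
    obtain \<pi> where \<pi>: "\<pi> \<in> hom G (H p)" "\<pi> ` carrier G = carrier (H p)"
      "coprime p (card (kernel G (H p) \<pi>))"
      using primary_projection[OF p] .
    have p1: "p > 1" using primary_component(1)[OF p] prime_gt_1_nat by blast
    have "card (characters p G) \<le> p ^ min_gens (H p)"
      using p1 by (intro card_characters_le[OF is_group G(2) primary_component(4)[OF p] \<pi>(1,2) _ \<pi>(3)]) auto
    then have "card (killed_tuples p k G) * (p - 1) * p ^ k \<le> p ^ min_gens (H p) * order G ^ k"
      using card_killed_tuples_le[OF is_group G(2) primary_component(1)[OF p]] mult_le_mono1 order_trans by blast
    then have "real (card (killed_tuples p k G) * (p - 1) * p ^ k) \<le> real (p ^ min_gens (H p) * order G ^ k)"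
      by (simp only: of_nat_le_iff)
    then have "real (card (killed_tuples p k G)) * (real p - 1) * real p ^ k
        \<le> real p ^ min_gens (H p) * real (order G) ^ k"
      using p1 by (simp add: of_nat_diff)
    then show "card (killed_tuples p k G) / real (order G) ^ k
        \<le> real p ^ min_gens (H p) / ((real p - 1) * real p ^ k)"
      using p1 o by (simp add: field_simps)
  qed
  finally show ?thesis using gen_prob_nongen[OF is_group G(2)] by simp
qed

end

section \<open>Passage to the limit\<close>

theorem lemma8p1:
  fixes G :: "nat \<Rightarrow> ('a, 'x) monoid_scheme"
    and P :: "nat \<Rightarrow> nat set"
    and H :: "nat \<Rightarrow> nat \<Rightarrow> ('b, 'y) monoid_scheme"
  assumes "\<And>N. comm_group (G N)"
    and "\<And>N. finite (carrier (G N))"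
    and "filterlim (\<lambda>N. order (G N)) at_top sequentially"
    and "\<And>N. primary_decomposition (G N) (P N) (H N)"
  shows
    "((\<exists>C::real. \<forall>N. \<exists>p\<in>P N.
          real p \<le> C \<and> real (min_gens (G N)) - real (min_gens (H N p)) \<le> C)
       \<longrightarrow> (\<forall>k::nat \<Rightarrow> nat. (\<lambda>N. gen_prob (k N) (G N)) \<longlonglongrightarrow> 1
             \<longrightarrow> filterlim (\<lambda>N. int (k N) - int (min_gens (G N))) at_top sequentially))
     \<and>
     ((\<exists>\<omega>::nat \<Rightarrow> real. filterlim \<omega> at_top sequentially \<and>
          (\<lambda>N. INF p\<in>{p \<in> P N. real p \<le> \<omega> N}.
             ereal (real (min_gens (G N)) - real (min_gens (H N p)))) \<longlonglongrightarrow> \<infinity>)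
       \<longrightarrow> (\<lambda>N. gen_prob (min_gens (G N) + 1) (G N)) \<longlonglongrightarrow> 1)"
proof (intro conjI impI allI)
  fix k :: "nat \<Rightarrow> nat"
  assume "\<exists>C::real. \<forall>N. \<exists>p\<in>P N.
      real p \<le> C \<and> real (min_gens (G N)) - real (min_gens (H N p)) \<le> C"
    and lim: "(\<lambda>N. gen_prob (k N) (G N)) \<longlonglongrightarrow> 1"
  then obtain C :: real where C: "\<And>N. \<exists>p\<in>P N.
      real p \<le> C \<and> real (min_gens (G N)) - real (min_gens (H N p)) \<le> C"
    by blast
  show "filterlim (\<lambda>N. int (k N) - int (min_gens (G N))) at_top sequentially"
    unfolding filterlim_at_top
  proof
    fix z :: int
    \<comment> \<open>If \<open>k N - min_gens (G N)\<close> were below \<open>z\<close>, the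
      exponent in \<open>gen_prob_le\<close> would be at most \<open>m\<close>. The base
      \<open>max C 1\<close> is positive and bounds \<open>p\<close>, giving a failure probability
      independent of \<open>N\<close>.\<close>
    define m where "m = nat (z + \<lceil>C\<rceil> + 1)"
    have "1 - 1 / max C 1 ^ m < 1" by simp
    then have "eventually (\<lambda>N. 1 - 1 / max C 1 ^ m < gen_prob (k N) (G N)) sequentially"
      using lim order_tendstoD(1) by blast
    then show "eventually (\<lambda>N. z \<le> int (k N) - int (min_gens (G N))) sequentially"
    proof eventually_elim
      case (elim N)
      show ?case
      proof (rule ccontr)
        assume "\<not> z \<le> int (k N) - int (min_gens (G N))"
        obtain p where p: "p \<in> P N" "real p \<le> C"
          "real (min_gens (G N)) - real (min_gens (H N p)) \<le> C"
          using C by blast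
        then have "int (min_gens (G N)) - int (min_gens (H N p)) \<le> \<lceil>C\<rceil>" by linarith
        with \<open>\<not> z \<le> _\<close> have e: "k N + 1 - min_gens (H N p) \<le> m" by (simp add: m_def)
        have p1: "p \<ge> 1"
          using primary_component(1)[OF assms(1,2,4) p(1)] prime_ge_1_nat by blast
        have "real p ^ (k N + 1 - min_gens (H N p)) \<le> real p ^ m"
          using e p1 by (intro power_increasing) auto
        also have "\<dots> \<le> max C 1 ^ m" using p(2) by (intro power_mono) auto
        finally have "1 / max C 1 ^ m \<le> 1 / real p ^ (k N + 1 - min_gens (H N p))"
          using p1 by (intro divide_left_mono) auto
        moreover have "gen_prob (k N) (G N) \<le> 1 - 1 / real p ^ (k N + 1 - min_gens (H N p))"
          by (rule gen_prob_le[OF assms(1,2,4) p(1)])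
        ultimately show False using elim by linarith
      qed
    qed
  qed
next
  assume "\<exists>\<omega>::nat \<Rightarrow> real. filterlim \<omega> at_top sequentially \<and>
      (\<lambda>N. INF p\<in>{p \<in> P N. real p \<le> \<omega> N}.
         ereal (real (min_gens (G N)) - real (min_gens (H N p)))) \<longlonglongrightarrow> \<infinity>"
  then obtain \<omega> :: "nat \<Rightarrow> real" where \<omega>: "filterlim \<omega> at_top sequentially"
    and inf: "(\<lambda>N. INF p\<in>{p \<in> P N. real p \<le> \<omega> N}.
      ereal (real (min_gens (G N)) - real (min_gens (H N p)))) \<longlonglongrightarrow> \<infinity>"
    by blast
  let ?d = "\<lambda>N. min_gens (G N)" and ?r = "\<lambda>N p. min_gens (H N p)"
  \<comment> \<open>Extending the summand of \<open>gen_prob_ge\<close> by zero outside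
    \<open>P N\<close> turns the finite sums over varying sets into series over one index set, as
    Tannery's theorem requires.\<close>
  define a where "a p N = (if p \<in> P N then
    real p ^ ?r N p / ((real p - 1) * real p ^ (?d N + 1)) else 0)" for p N
  have p2: "p \<ge> 2" if "p \<in> P N" for p N
    using primary_component(1)[OF assms(1,2,4) that] prime_ge_2_nat by blast
  have rd: "?r N p \<le> ?d N" if "p \<in> P N" for p N
    by (rule primary_min_gens_le[OF assms(1,2,4) that])
  have a_eq: "a p N = 1 / (real p ^ (?d N - ?r N p) * ((real p - 1) * real p))" if "p \<in> P N" for p N
  proof -
    have "real p ^ (?d N + 1) = real p ^ ?r N p * (real p ^ (?d N - ?r N p) * real p)"
      using rd[OF that] by (simp flip: power_add)
    then show ?thesis using that p2[OF that] by (simp add: a_def)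
  qed
  have a0: "a p N \<ge> 0" for p N using p2 by (force simp: a_def)
  \<comment> \<open>One factor decays as the rank gap grows, the other is summable over
    \<open>p\<close>; the second power of \<open>p\<close> comes from \<open>(p - 1) * p\<close>,
    whose factor \<open>p\<close> is due to the extra random element.\<close>
  have a_le: "a p N \<le> (1 / 2) ^ (?d N - ?r N p) * (2 / real p ^ 2)" if "p \<in> P N" for p N
  proof -
    have p: "real p \<ge> 2" using p2[OF that] by simp
    have "(2::real) ^ (?d N - ?r N p) * (real p ^ 2 / 2) \<le> real p ^ (?d N - ?r N p) * ((real p - 1) * real p)"
    proof (intro mult_mono power_mono)
      have "real p * 2 \<le> real p * real p" using p by (intro mult_left_mono) auto
      then show "real p ^ 2 / 2 \<le> (real p - 1) * real p" by (simp add: power2_eq_square algebra_simps)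
    qed (use p in auto)
    then have "a p N \<le> 1 / ((2::real) ^ (?d N - ?r N p) * (real p ^ 2 / 2))"
      unfolding a_eq[OF that] using p by (intro divide_left_mono) auto
    then show ?thesis by (simp add: power_one_over field_simps)
  qed
  \<comment> \<open>At \<open>p = 0\<close> both sides are 0, because 0 is not in \<open>P N\<close>
    and division by zero yields 0.\<close>
  have a_M: "norm (a p N) \<le> 2 / real p ^ 2" for p N
  proof (cases "p \<in> P N")
    case True
    have "a p N \<le> 1 * (2 / real p ^ 2)"
      using a_le[OF True] by (rule order_trans) (intro mult_right_mono power_le_one; simp)
    then show ?thesis using a0 by simp
  qed (simp add: a_def)
  \<comment> \<open>A fixed \<open>p\<close> eventually lies below \<open>\<omega> N\<close>. From
    then on either \<open>p\<close> is outside \<open>P N\<close> and the term is 0, or the infimum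
    forces the rank gap of \<open>p\<close> above any given \<open>m\<close>.\<close>
  have a_lim: "(\<lambda>N. a p N) \<longlonglongrightarrow> 0" for p
  proof (rule LIMSEQ_I)
    fix e :: real assume "e > 0"
    obtain m where m: "(1 / 2 :: real) ^ m < e"
      using real_arch_pow_inv[OF \<open>e > 0\<close>, of "1/2"] by auto
    have "eventually (\<lambda>N. real p \<le> \<omega> N) sequentially"
      using \<omega> by (simp add: filterlim_at_top)
    moreover have "eventually (\<lambda>N. ereal (real m) < (INF p\<in>{p \<in> P N. real p \<le> \<omega> N}.
        ereal (real (?d N) - real (?r N p)))) sequentially"
      using inf by (rule order_tendstoD) simp
    ultimately have "eventually (\<lambda>N. norm (a p N - 0) < e) sequentially"
    proof eventually_elim
      case (elim N)
      show ?case
      proof (cases "p \<in> P N")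
        case True
        have "ereal (real m) < ereal (real (?d N) - real (?r N p))"
          using elim(2) by (rule less_le_trans) (rule INF_lower, use True elim(1) in auto)
        then have "m \<le> ?d N - ?r N p" by simp
        then have "(1 / 2 :: real) ^ (?d N - ?r N p) \<le> (1 / 2) ^ m" by (intro power_decreasing) auto
        moreover have "2 / real p ^ 2 \<le> 1"
          using p2[OF True] power_mono[of 2 "real p" 2] by (simp add: divide_le_eq)
        ultimately have "(1 / 2) ^ (?d N - ?r N p) * (2 / real p ^ 2) \<le> (1 / 2) ^ m * 1"
          by (intro mult_mono) auto
        then show ?thesis using a_le[OF True] a0[of p N] m by simp
      qed (use \<open>e > 0\<close> in \<open>simp add: a_def\<close>)
    qed
    then show "\<exists>n0. \<forall>N\<ge>n0. norm (a p N - 0) < e" by (simp add: eventually_sequentially)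
  qed
  have "summable (\<lambda>p. 2 * inverse (real p ^ 2))"
    by (intro summable_mult inverse_power_summable) simp
  then have "summable (\<lambda>p. 2 / real p ^ 2)" by (simp add: divide_inverse)
  moreover have "eventually (\<lambda>(p, N). norm (a p N) \<le> 2 / real p ^ 2) (at_top \<times>\<^sub>F sequentially)"
    using a_M by (intro always_eventually) auto
  ultimately have "(\<lambda>N. \<Sum>p. a p N) \<longlonglongrightarrow> (\<Sum>p::nat. 0)"
    using tannerys_theorem[OF a_lim] by simp
  \<comment> \<open>The series collapses to the finite sum because \<open>a p N\<close> vanishes
    outside the finite set \<open>P N\<close>.\<close>
  moreover have "(\<Sum>p. a p N) = (\<Sum>p\<in>P N. a p N)" for N
    using assms(4)[of N] by (intro suminf_finite) (auto simp: primary_decomposition_def a_def)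
  ultimately have "(\<lambda>N. 1 - (\<Sum>p\<in>P N. a p N)) \<longlonglongrightarrow> 1 - 0"
    by (intro tendsto_diff tendsto_const) simp
  then have lower: "(\<lambda>N. 1 - (\<Sum>p\<in>P N. a p N)) \<longlonglongrightarrow> 1" by simp
  show "(\<lambda>N. gen_prob (?d N + 1) (G N)) \<longlonglongrightarrow> 1"
  proof (rule tendsto_sandwich[OF _ _ lower tendsto_const])
    show "eventually (\<lambda>N. 1 - (\<Sum>p\<in>P N. a p N) \<le> gen_prob (?d N + 1) (G N)) sequentially"
    proof (intro always_eventually allI)
      fix N
      show "1 - (\<Sum>p\<in>P N. a p N) \<le> gen_prob (?d N + 1) (G N)"
        using gen_prob_ge[OF assms(1,2,4), of N "?d N + 1"] by (simp add: a_def)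
    qed
    show "eventually (\<lambda>N. gen_prob (?d N + 1) (G N) \<le> 1) sequentially"
      by (simp add: gen_prob_def)
  qed
qed

end
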